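(* Let $X,Y$ be real Banach spaces and let $F:\mathcal{D}(F)\subseteq X\to Y$, $\Omega:\mathcal{D}(\Omega)\subseteq X\to[0,\infty)$, $\mathcal{D}=\mathcal{D}(F)\cap\mathcal{D}(\Omega)$, $\psi:[0,\infty)\to[0,\infty)$, $y\in F(\mathcal{D}(F))$, $x^\dagger\in\mathcal{D}$ and $\xi=\Omega'(x^\dagger)\in X^*$ satisfy the standing assumptions (A1)-(A6) and (B1)-(B3) listed in the context; let $a,b>0$ be the constants from (A6). Assume that $\psi$ and $\varphi$ are index functions which are twice differentiable on the interior of their domains, with $\psi$ strictly convex and $\varphi$ concave. This ensures the existence of an index function $f$ defined by $$f(0)=0,\qquad f(s)=\left[\frac{\psi'}{\varphi'}\circ\varphi^{-1}\right](s)\quad (s>0).$$ Let $\alpha_{\max}>0$ and $\rho:=\alpha_{\max}(1+\Omega(x^\dagger))$. Let there exist constants $0\le\beta_1<1$ and $\beta_2>0$ such that the variational inequality $$\langle \xi,x^\dagger-x\rangle_{X^*,X}\le \beta_1 D_\xi(x,x^\dagger)+\beta_2\,\varphi(\|F(x)-F(x^\dagger)\|_Y)\qquad\text{for all }x\in\mathcal{M}_{\alpha_{\max}}(\rho)$$ holds. Then we have the convergence rate of Tikhonov regularized solutions $$D_\xi(x_{\alpha(\delta)}^\delta,x^\dagger)=\mathcal{O}(\varphi(\delta))\quad\text{as }\delta\to0$$ for the a priori parameter choice $$\alpha(\delta)=\frac{1}{a\beta_2}f(\varphi(\delta)),$$ where, for data $y^\delta\in Y$ with $\|y^\delta-y\|_Y\le\delta$,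 $x_\alpha^\delta$ denotes a minimizer over $\mathcal{D}$ of $T_\alpha^\delta(x)=\psi(\|F(x)-y^\delta\|_Y)+\alpha\,\Omega(x)$.
   Context: Index function: a continuous, strictly increasing function $\eta:[0,\infty)\to[0,\infty)$ with $\eta(0)=0$; restrictions of such functions to a segment $[0,\overline a]$, $0<\overline a<\infty$, are also called index functions. Setting: the equation $F(x)=y$ is considered, with exact right-hand side $y\in F(\mathcal{D}(F))$. For $\alpha>0$ put $T^0_\alpha(x)=\psi(\|F(x)-y\|_Y)+\alpha\Omega(x)$ and, for $c\ge0$, $\mathcal{M}_\alpha(c):=\{x\in\mathcal{D}: T^0_\alpha(x)\le c\}$. Standing assumptions: (A1) $X,Y$ are real Banach spaces with duals $X^*,Y^*$ and dual pairings $\langle\cdot,\cdot\rangle_{X^*,X}$, $\langle\cdot,\cdot\rangle_{Y^*,Y}$; $\rightharpoonup$ denotes weak convergence. (A2) $F$ is weakly-weakly sequentially continuous and $\mathcal{D}(F)$ is weakly sequentially closed: if $x_k\in\mathcal{D}(F)$ and $x_k\rightharpoonup x$ in $X$, then $x\in\mathcal{D}(F)$ and $F(x_k)\rightharpoonup F(x)$ in $Y$. (A3) $\mathcal{D}(\Omega)$ is convex and $\Omega$ is convex and weakly sequentially lower semi-continuous. (A4) $\mathcal{D}=\mathcal{D}(F)\cap\mathcal{D}(\Omega)\neq\emptyset$. (A5) For every $\alpha>0$ and $c\ge0$, every sequence in $\mathcal{M}_\alpha(c)$ has a subsequence that converges weakly in $X$ to some element of $X$. (A6) $\psi:[0,\infty)\to[0,\infty)$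 is an index function and there are constants $a>0$, $b>0$ with $\psi(u+v)\le a\psi(u)+b\psi(v)$ for all $u,v\in[0,\infty)$. (B1) $x^\dagger\in\mathcal{D}$ is an $\Omega$-minimizing solution of $F(x)=y$, i.e. $F(x^\dagger)=y$ and $\Omega(x^\dagger)=\min\{\Omega(x):F(x)=y,\ x\in\mathcal{D}\}<\infty$. (B2) $F$ is Gâteaux differentiable at $x^\dagger$ with Gâteaux derivative $F'(x^\dagger)\in\mathcal{L}(X,Y)$ (bounded linear operators from $X$ to $Y$). (B3) $\Omega$ is Gâteaux differentiable at $x^\dagger$ with Gâteaux derivative $\xi=\Omega'(x^\dagger)\in X^*$, i.e. the subdifferential $\partial\Omega(x^\dagger)=\{\xi\}$ is a singleton. Bregman distance: $D_\xi(x,x^\dagger):=\Omega(x)-\Omega(x^\dagger)-\langle\xi,x-x^\dagger\rangle_{X^*,X}$ for $x\in\mathcal{D}(\Omega)$. The $\mathcal{O}$-statement means: there are $c_0>0$ and $\delta_0>0$ with $D_\xi(x_{\alpha(\delta)}^\delta,x^\dagger)\le c_0\varphi(\delta)$ for all $0<\delta\le\delta_0$.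
   Formalization: The statement also assumes f(s)→0 as s→0+: the claim that f is always an index function is false (ψ(t)=t+t², φ(t)=t gives f(s)=1+2s for s>0), and without continuity of f at 0 the convergence rate can fail. *)

theory Defs
  imports "HOL-Analysis.Analysis"
begin

text \<open>Partial functions such as \<open>F : D(F) \<subseteq> X \<rightarrow> Y\<close> and \<open>\<Omega> : D(\<Omega>) \<subseteq> X \<rightarrow> [0,\<infinity>)\<close> are total
  functions together with their domains \<open>DF\<close>, \<open>DW\<close>; values off the domain are never used.
  The dual space of \<open>'a\<close> is the type \<open>'a \<Rightarrow>\<^sub>L real\<close>.\<close>

subsection \<open>Weak sequential notions\<close>

definition weakly_tendsto :: "(nat \<Rightarrow> 'a::real_normed_vector) \<Rightarrow> 'a \<Rightarrow> bool"
  where "weakly_tendsto u x \<longleftrightarrow>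
    (\<forall>g :: 'a \<Rightarrow>\<^sub>L real. (\<lambda>k. blinfun_apply g (u k)) \<longlonglongrightarrow> blinfun_apply g x)"

definition weakly_seq_continuous_closed_on ::
    "'a::real_normed_vector set \<Rightarrow> ('a \<Rightarrow> 'b::real_normed_vector) \<Rightarrow> bool"
  where "weakly_seq_continuous_closed_on D F \<longleftrightarrow>
    (\<forall>u x. (\<forall>k. u k \<in> D) \<and> weakly_tendsto u x \<longrightarrow>
      x \<in> D \<and> weakly_tendsto (\<lambda>k. F (u k)) (F x))"

definition weakly_seq_lsc_on :: "'a::real_normed_vector set \<Rightarrow> ('a \<Rightarrow> real) \<Rightarrow> bool"
  where "weakly_seq_lsc_on D W \<longleftrightarrow>
    (\<forall>u. \<forall>x\<in>D. (\<forall>k. u k \<in> D) \<and> weakly_tendsto u x \<longrightarrow>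
      ereal (W x) \<le> liminf (\<lambda>k. ereal (W (u k))))"

definition weakly_seq_precompact :: "'a::real_normed_vector set \<Rightarrow> bool"
  where "weakly_seq_precompact M \<longleftrightarrow>
    (\<forall>u. (\<forall>k. u k \<in> M) \<longrightarrow> (\<exists>r x. strict_mono (r :: nat \<Rightarrow> nat) \<and> weakly_tendsto (u \<circ> r) x))"

subsection \<open>Derivatives, subdifferential, Bregman distance\<close>

text \<open>The difference quotient is only formed at points of the domain \<open>D\<close>. If every line through
  \<open>x\<close> meets \<open>D\<close> in a neighbourhood of \<open>x\<close>, this is the usual two-sided limit.\<close>

definition has_gateaux_derivative_on ::
    "'a::real_normed_vector set \<Rightarrow> ('a \<Rightarrow> 'b::real_normed_vector) \<Rightarrow> ('a \<Rightarrow>\<^sub>L 'b) \<Rightarrow> 'a \<Rightarrow> bool"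
  where "has_gateaux_derivative_on D F F' x \<longleftrightarrow>
    (\<forall>h. ((\<lambda>t. (F (x + t *\<^sub>R h) - F x) /\<^sub>R t) \<longlongrightarrow> blinfun_apply F' h)
           (at 0 within {t::real. x + t *\<^sub>R h \<in> D}))"

definition subdifferential ::
    "'a::real_normed_vector set \<Rightarrow> ('a \<Rightarrow> real) \<Rightarrow> 'a \<Rightarrow> ('a \<Rightarrow>\<^sub>L real) set"
  where "subdifferential D W x = {\<eta>. \<forall>z\<in>D. W z \<ge> W x + blinfun_apply \<eta> (z - x)}"

definition bregman ::
    "('a::real_normed_vector \<Rightarrow> real) \<Rightarrow> ('a \<Rightarrow>\<^sub>L real) \<Rightarrow> 'a \<Rightarrow> 'a \<Rightarrow> real"
  where "bregman W \<xi> x x0 = W x - W x0 - blinfun_apply \<xi> (x - x0)"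

subsection \<open>Index functions\<close>

definition index_domain :: "real set \<Rightarrow> bool"
  where "index_domain I \<longleftrightarrow> I = {0..} \<or> (\<exists>c>0. I = {0..c})"

definition index_function_on :: "real set \<Rightarrow> (real \<Rightarrow> real) \<Rightarrow> bool"
  where "index_function_on I f \<longleftrightarrow>
    f ` I \<subseteq> {0..} \<and> continuous_on I f \<and> strict_mono_on I f \<and> f 0 = 0"

definition twice_differentiable_on :: "real set \<Rightarrow> (real \<Rightarrow> real) \<Rightarrow> bool"
  where "twice_differentiable_on S f \<longleftrightarrow>
    (\<forall>t\<in>S. f differentiable (at t) \<and> deriv f differentiable (at t))"

definition strictly_convex_on :: "real set \<Rightarrow> (real \<Rightarrow> real) \<Rightarrow> bool"
  where "strictly_convex_on S f \<longleftrightarrow> convex S \<and>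
    (\<forall>s\<in>S. \<forall>t\<in>S. \<forall>u>0. \<forall>v>0. s \<noteq> t \<and> u + v = 1 \<longrightarrow> f (u * s + v * t) < u * f s + v * f t)"

text \<open>\<open>f(0) = 0\<close> and \<open>f(s) = (\<psi>'/\<phi>')(\<phi>\<^sup>-\<^sup>1(s))\<close>, where \<open>I\<close> is the domain of \<open>\<phi>\<close>. The
  formula is meaningful for \<open>s\<close> in the image under \<open>\<phi>\<close> of the interior of \<open>I\<close>.  For strictly convex
  \<open>\<psi>\<close> and concave \<open>\<phi>\<close> it is continuous at \<open>0\<close> unless \<open>\<psi>'(0+) > 0\<close> and \<open>\<phi>'(0+) < \<infinity>\<close>,
  as for \<open>\<psi>(t) = t + t\<^sup>2\<close>, \<open>\<phi>(t) = t\<close>, where \<open>f(s) = 1 + 2s\<close> for \<open>s > 0\<close>.\<close>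

definition quotient_index :: "real set \<Rightarrow> (real \<Rightarrow> real) \<Rightarrow> (real \<Rightarrow> real) \<Rightarrow> real \<Rightarrow> real"
  where "quotient_index I \<psi> \<phi> s =
    (if s = 0 then 0 else deriv \<psi> (inv_into I \<phi> s) / deriv \<phi> (inv_into I \<phi> s))"

subsection \<open>Tikhonov functional\<close>

definition tikhonov ::
    "(real \<Rightarrow> real) \<Rightarrow> ('a \<Rightarrow> 'b::real_normed_vector) \<Rightarrow> ('a \<Rightarrow> real) \<Rightarrow> 'b \<Rightarrow> real \<Rightarrow> 'a \<Rightarrow> real"
  where "tikhonov \<psi> F W z \<alpha> x = \<psi> (norm (F x - z)) + \<alpha> * W x"

definition tikhonov_sublevel ::
    "(real \<Rightarrow> real) \<Rightarrow> ('a \<Rightarrow> 'b::real_normed_vector) \<Rightarrow> ('a \<Rightarrow> real) \<Rightarrow> 'a set \<Rightarrow> 'b \<Rightarrow> real \<Rightarrow> real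
      \<Rightarrow> 'a set"
  where "tikhonov_sublevel \<psi> F W D y \<alpha> c = {x \<in> D. tikhonov \<psi> F W y \<alpha> x \<le> c}"

definition minimizing_solution ::
    "('a \<Rightarrow> 'b) \<Rightarrow> ('a \<Rightarrow> real) \<Rightarrow> 'a set \<Rightarrow> 'b \<Rightarrow> 'a \<Rightarrow> bool"
  where "minimizing_solution F W D y x0 \<longleftrightarrow> is_arg_min W (\<lambda>x. x \<in> D \<and> F x = y) x0"

end

theory Submission
  imports Defs
begin

text \<open>
  Both claims come from comparing \<open>\<psi>\<close> and \<open>\<phi>\<close> with their tangents at one point: the convex
  \<open>\<psi>\<close> lies above its tangent, the concave \<open>\<phi>\<close> below.

  The tangents give \<open>\<psi>' > 0\<close> and \<open>\<phi>' > 0\<close>, and they show that \<open>\<psi>'\<close> is strictly increasing and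
  \<open>\<phi>'\<close> decreasing. So \<open>\<psi>'/\<phi>'\<close> is positive and strictly increasing, and composing it with the
  increasing continuous inverse of \<open>\<phi>\<close> gives the index function \<open>f\<close>
  (\<open>index_function_on_quotient_index\<close>).

  For the rate, let \<open>x\<close> minimize the Tikhonov functional for noise level \<open>\<delta>\<close> and parameter
  \<open>\<alpha>\<close>, let \<open>s = \<parallel>F x - y\<parallel>\<close>, and let \<open>d\<close> be the Bregman distance of \<open>x\<close> from the exact
  solution \<open>x\<^sub>0\<close>. Comparing the Tikhonov values of \<open>x\<close> and \<open>x\<^sub>0\<close> and using
  \<open>\<psi>(u + v) \<le> a \<psi>(u) + b \<psi>(v)\<close> bounds \<open>\<alpha> (\<Omega> x - \<Omega> x\<^sub>0)\<close> by \<open>(1 + b/a) \<psi>(\<delta>) - \<psi>(s)/a\<close>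
  (\<open>penalty_gap_le\<close>). With the variational inequality this gives
  \<open>(1 - \<beta>1) d \<le> (1 + b/a) \<psi>(\<delta>)/\<alpha> + (\<beta>2 \<phi>(s) - \<psi>(s)/(a \<alpha>))\<close>.
  The parameter choice means \<open>1/(a \<alpha>) = \<beta>2 q\<close> with \<open>q = \<phi>'(\<delta>)/\<psi>'(\<delta>)\<close>. This \<open>q\<close> is exactly
  the weight for which the slopes of \<open>\<phi>\<close> and \<open>q \<psi>\<close> agree at \<open>\<delta>\<close>, so the concave function
  \<open>\<phi> - q \<psi>\<close> is largest at \<open>\<delta>\<close>, and the last bracket is at most \<open>\<beta>2 \<phi>(\<delta>)\<close>
  whatever \<open>s\<close> is. The tangents at \<open>\<delta>\<close>, evaluated at \<open>0\<close>, give \<open>q \<psi>(\<delta>) \<le> \<phi>(\<delta>)\<close>, so the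
  first term is also a multiple of \<open>\<phi>(\<delta>)\<close>
  (\<open>weighted_tangent_bounds\<close>).

  The variational inequality is available only on a sublevel set of the noise-free functional.
  The same estimates, without the variational inequality, bound \<open>\<Omega> x\<close> by
  \<open>\<Omega> x\<^sub>0 + a \<beta>2 \<phi>(\<delta>)\<close> and, since \<open>\<alpha> \<rightarrow> 0\<close> as \<open>\<delta> \<rightarrow> 0\<close>, make \<open>\<psi>(s)\<close> small, so
  minimizers lie in that sublevel set for small \<open>\<delta>\<close>.
\<close>

section \<open>Tangents of convex and concave functions\<close>

lemma strictly_convex_on_imp_convex_on:
  assumes "strictly_convex_on S f"
  shows "convex_on S f"
proof (rule convex_onI)
  show "convex S" using assms by (simp add: strictly_convex_on_def)
  fix t x y :: real
  assume t: "0 < t" "t < 1" and xy: "x \<in> S" "y \<in> S"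
  show "f ((1 - t) *\<^sub>R x + t *\<^sub>R y) \<le> (1 - t) * f x + t * f y"
  proof (cases "x = y")
    case True
    then show ?thesis by (simp add: algebra_simps)
  next
    case False
    have "1 - t > 0" "(1 - t) + t = 1" using t by auto
    then have "f ((1 - t) * x + t * y) < (1 - t) * f x + t * f y"
      using assms xy False t(1) unfolding strictly_convex_on_def by blast
    then show ?thesis by simp
  qed
qed

lemma convex_on_above_deriv_tangent:
  fixes f :: "real \<Rightarrow> real"
  assumes "convex_on S f" "t \<in> interior S" "s \<in> S" "f differentiable (at t)"
  shows "f t + deriv f t * (s - t) \<le> f s"
proof -
  have "convex S" using assms(1) by (simp add: convex_on_def)
  then have conn: "connected S" by (rule convex_connected)
  have "(f has_real_derivative deriv f t) (at t within S)"
    using assms(4) DERIV_deriv_iff_real_differentiable has_field_derivative_at_within by blast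
  from convex_on_imp_above_tangent[OF assms(1) conn assms(2,3) this]
  show ?thesis by simp
qed

lemma concave_on_below_deriv_tangent:
  fixes f :: "real \<Rightarrow> real"
  assumes "concave_on S f" "t \<in> interior S" "s \<in> S" "f differentiable (at t)"
  shows "f s \<le> f t + deriv f t * (s - t)"
proof -
  have "convex_on S (\<lambda>x. - f x)" using assms(1) by (simp add: concave_on_def)
  moreover have "(\<lambda>x. - f x) differentiable (at t)"
    using assms(4) by (rule differentiable_minus)
  moreover have "deriv (\<lambda>x. - f x) t = - deriv f t"
    using assms(4) DERIV_deriv_iff_real_differentiable DERIV_imp_deriv DERIV_minus by blast
  ultimately show ?thesis
    using convex_on_above_deriv_tangent[of S "\<lambda>x. - f x" t s] assms(2,3) by simp
qed

text \<open>Convexity at the midpoint of \<open>s\<close> and \<open>t\<close> is strict, so the tangent inequality from \<open>s\<close> to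
  that midpoint leaves room for strictness at \<open>t\<close>.\<close>

lemma strictly_convex_on_above_deriv_tangent:
  fixes f :: "real \<Rightarrow> real"
  assumes "strictly_convex_on S f" "s \<in> interior S" "t \<in> S" "f differentiable (at s)" "s \<noteq> t"
  shows "f s + deriv f s * (t - s) < f t"
proof -
  let ?m = "(1/2) * s + (1/2) * t"
  have s: "s \<in> S" using assms(2) interior_subset by blast
  have "(1/2::real) > 0" "(1/2::real) + 1/2 = 1" by auto
  then have mid: "f ?m < (1/2) * f s + (1/2) * f t"
    using assms(1,3,5) s unfolding strictly_convex_on_def by blast
  have "convex S" using assms(1) by (simp add: strictly_convex_on_def)
  then have "(1/2) *\<^sub>R s + (1/2) *\<^sub>R t \<in> S" using s assms(3) by (intro convexD) auto
  then have "?m \<in> S" by simp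
  from convex_on_above_deriv_tangent[OF strictly_convex_on_imp_convex_on[OF assms(1)] assms(2) this assms(4)]
  have "f s + deriv f s * (?m - s) \<le> f ?m" .
  moreover have "deriv f s * (?m - s) = deriv f s * (t - s) / 2" by (simp add: field_simps)
  ultimately show ?thesis using mid by linarith
qed

lemma strictly_convex_on_deriv_strict_mono:
  fixes f :: "real \<Rightarrow> real"
  assumes "strictly_convex_on S f" "s \<in> interior S" "t \<in> interior S"
    "f differentiable (at s)" "f differentiable (at t)" "s < t"
  shows "deriv f s < deriv f t"
proof -
  have "s \<in> S" "t \<in> S" using assms(2,3) interior_subset by blast+
  then have "f s + deriv f s * (t - s) < f t" "f t + deriv f t * (s - t) < f s"
    using assms by (auto intro!: strictly_convex_on_above_deriv_tangent)
  then have "deriv f s * (t - s) < deriv f t * (t - s)" by (simp add: algebra_simps)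
  then show ?thesis using assms(6) by simp
qed

lemma concave_on_deriv_antimono:
  fixes f :: "real \<Rightarrow> real"
  assumes "concave_on S f" "s \<in> interior S" "t \<in> interior S"
    "f differentiable (at s)" "f differentiable (at t)" "s < t"
  shows "deriv f t \<le> deriv f s"
proof -
  have "s \<in> S" "t \<in> S" using assms(2,3) interior_subset by blast+
  then have "f t \<le> f s + deriv f s * (t - s)" "f s \<le> f t + deriv f t * (s - t)"
    using assms by (auto intro!: concave_on_below_deriv_tangent)
  then have "deriv f t * (t - s) \<le> deriv f s * (t - s)" by (simp add: algebra_simps)
  then show ?thesis using assms(6) by simp
qed

section \<open>The quotient of the derivatives as an index function\<close>

lemma index_domain_cases:
  assumes "index_domain I"
  obtains "I = {0..}" "interior I = {0<..}"
  | c where "c > 0" "I = {0..c}" "interior I = {0<..<c}"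
  using assms unfolding index_domain_def by auto

lemma index_domain_basics:
  assumes "index_domain I"
  shows "0 \<in> I" "interior I \<subseteq> I" "I \<subseteq> {0..}" "interior I \<subseteq> {0<..}"
  by (use assms in \<open>cases rule: index_domain_cases; auto\<close>)+

lemma index_domain_interior_larger:
  assumes "index_domain I" "t \<in> interior I"
  obtains u where "u \<in> I" "t < u"
proof (use assms(1) in \<open>cases rule: index_domain_cases\<close>)
  case 1
  then show ?thesis using that[of "t + 1"] assms(2) by auto
next
  case (2 c)
  then show ?thesis using that[of c] assms(2) by auto
qed

lemma eventually_interior_index_domain:
  assumes "index_domain I"
  shows "eventually (\<lambda>t. t \<in> interior I) (at_right 0)"
  using assms
proof (cases rule: index_domain_cases)
  case 1
  then show ?thesis by (simp add: eventually_at_right_less)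
next
  case (2 c)
  then show ?thesis using eventually_at_right_real[OF 2(1)] by simp
qed

text \<open>A zero derivative at an interior point would make the tangent there a constant upper bound
  that is already attained, leaving no larger value further to the right.\<close>

lemma concave_index_deriv_pos:
  assumes "index_domain I" "index_function_on I \<phi>" "concave_on I \<phi>"
    "t \<in> interior I" "\<phi> differentiable (at t)"
  shows "0 < deriv \<phi> t"
proof -
  obtain u where u: "u \<in> I" "t < u" using index_domain_interior_larger[OF assms(1,4)] .
  have "t \<in> I" using assms(1,4) index_domain_basics(2) by blast
  then have "\<phi> t < \<phi> u"
    using assms(2) u unfolding index_function_on_def strict_mono_on_def by blast
  moreover have "\<phi> u \<le> \<phi> t + deriv \<phi> t * (u - t)"
    using concave_on_below_deriv_tangent[OF assms(3,4) u(1) assms(5)] .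
  ultimately have "0 < deriv \<phi> t * (u - t)" by linarith
  then show ?thesis using u(2) by (simp add: zero_less_mult_iff)
qed

lemma index_function_on_nonneg: "index_function_on I \<phi> \<Longrightarrow> t \<in> I \<Longrightarrow> 0 \<le> \<phi> t"
  unfolding index_function_on_def by auto

lemma strictly_convex_index_deriv_pos:
  assumes "index_function_on {0..} \<psi>" "strictly_convex_on {0..} \<psi>"
    "t > 0" "\<psi> differentiable (at t)"
  shows "0 < deriv \<psi> t"
proof -
  have "t \<in> interior {0..}" using assms(3) by simp
  from strictly_convex_on_above_deriv_tangent[OF assms(2) this _ assms(4), of 0]
  have "\<psi> t < deriv \<psi> t * t" using assms(1,3) by (simp add: index_function_on_def)
  moreover have "0 \<le> \<psi> t" using index_function_on_nonneg[OF assms(1)] assms(3) by simp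
  ultimately have "0 < deriv \<psi> t * t" by linarith
  then show ?thesis using assms(3) by (simp add: zero_less_mult_iff)
qed

lemma index_function_on_pos:
  assumes "index_function_on I \<phi>" "0 \<in> I" "t \<in> I" "0 < t"
  shows "0 < \<phi> t"
  using assms unfolding index_function_on_def strict_mono_on_def by metis

lemma index_function_on_tendsto_0:
  assumes "index_domain I" "index_function_on I \<phi>"
  shows "(\<phi> \<longlongrightarrow> 0) (at_right 0)"
proof -
  have "(\<phi> \<longlongrightarrow> \<phi> 0) (at 0 within I)"
    using assms(2) index_domain_basics(1)[OF assms(1)]
    unfolding index_function_on_def continuous_on_def by blast
  moreover have "at_right 0 \<le> at 0 within I"
  proof (unfold le_filter_def, intro allI impI)
    fix P assume "eventually P (at 0 within I)"
    then have "eventually (\<lambda>x. x \<in> I \<longrightarrow> P x) (at_right 0)"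
      unfolding eventually_at_filter by (auto elim: eventually_mono)
    with eventually_interior_index_domain[OF assms(1)] show "eventually P (at_right 0)"
      by eventually_elim (use index_domain_basics(2)[OF assms(1)] in auto)
  qed
  ultimately have "(\<phi> \<longlongrightarrow> \<phi> 0) (at_right 0)" by (rule tendsto_mono[rotated])
  then show ?thesis using assms(2) by (simp add: index_function_on_def)
qed

lemma quotient_index_image:
  assumes "index_domain I" "index_function_on I \<phi>" "t \<in> interior I"
  shows "quotient_index I \<psi> \<phi> (\<phi> t) = deriv \<psi> t / deriv \<phi> t"
proof -
  have t: "t \<in> I" "0 < t" using assms(1,3) index_domain_basics(2,4) by blast+
  have "inj_on \<phi> I"
    using assms(2) by (auto simp: index_function_on_def intro: strict_mono_on_imp_inj_on)
  moreover have "\<phi> t \<noteq> 0"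
    using index_function_on_pos[OF assms(2) index_domain_basics(1)[OF assms(1)] t] by simp
  ultimately show ?thesis using t(1) by (simp add: quotient_index_def)
qed

lemma isCont_inv_into_index_function:
  assumes "index_domain I" "index_function_on I \<phi>" "t \<in> interior I"
  shows "isCont (inv_into I \<phi>) (\<phi> t)"
proof -
  have "inj_on \<phi> I"
    using assms(2) by (auto simp: index_function_on_def intro: strict_mono_on_imp_inj_on)
  obtain e where e: "e > 0" "cball t e \<subseteq> interior I"
    using assms(3) open_contains_cball open_interior by blast
  have sub: "z \<in> interior I" if "\<bar>z - t\<bar> \<le> e" for z
    using e(2) that by (auto simp: dist_real_def subset_iff abs_minus_commute)
  show ?thesis
  proof (rule isCont_inverse_function[where f = \<phi> and x = t, OF e(1)])
    fix z assume z: "\<bar>z - t\<bar> \<le> e"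
    show "inv_into I \<phi> (\<phi> z) = z"
      using sub[OF z] interior_subset \<open>inj_on \<phi> I\<close> by (blast intro: inv_into_f_f)
    have "continuous_on (interior I) \<phi>"
      using assms(2) continuous_on_subset interior_subset unfolding index_function_on_def by blast
    then show "isCont \<phi> z" using sub[OF z] continuous_on_eq_continuous_at by blast
  qed
qed

text \<open>Composed with \<open>\<phi>\<close>, the function is \<open>\<psi>'/\<phi>'\<close>, whose numerator increases strictly and
  whose denominator decreases. Twice differentiability makes the two derivatives
  continuous. The limit at \<open>0\<close> has to be assumed, since \<open>\<psi>'/\<phi>'\<close> can have a positive limit
  there.\<close>

lemma index_function_on_quotient_index:
  assumes I: "index_domain I"
    and \<phi>: "index_function_on I \<phi>" "concave_on I \<phi>" "twice_differentiable_on (interior I) \<phi>"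
    and \<psi>: "index_function_on {0..} \<psi>" "strictly_convex_on {0..} \<psi>"
      "twice_differentiable_on {0<..} \<psi>"
    and lim: "(quotient_index I \<psi> \<phi> \<longlongrightarrow> 0) (at_right 0)"
  shows "index_function_on (insert 0 (\<phi> ` interior I)) (quotient_index I \<psi> \<phi>)"
proof -
  let ?f = "quotient_index I \<psi> \<phi>" and ?J = "\<phi> ` interior I"
  have f0: "?f 0 = 0" by (simp add: quotient_index_def)
  have d\<phi>: "\<phi> differentiable (at t)" "deriv \<phi> differentiable (at t)" if "t \<in> interior I" for t
    using \<phi>(3) that by (auto simp: twice_differentiable_on_def)
  have d\<psi>: "\<psi> differentiable (at t)" "deriv \<psi> differentiable (at t)" if "t > 0" for t
    using \<psi>(3) that by (auto simp: twice_differentiable_on_def)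
  have t0: "t > 0" "t \<in> I" if "t \<in> interior I" for t
    using that index_domain_basics[OF I] by auto
  have p\<phi>: "deriv \<phi> t > 0" if "t \<in> interior I" for t
    using concave_index_deriv_pos[OF I \<phi>(1,2) that d\<phi>(1)[OF that]] .
  have p\<psi>: "deriv \<psi> t > 0" if "t > 0" for t
    using strictly_convex_index_deriv_pos[OF \<psi>(1,2) that d\<psi>(1)[OF that]] .
  have val: "?f (\<phi> t) = deriv \<psi> t / deriv \<phi> t" if "t \<in> interior I" for t
    using quotient_index_image[OF I \<phi>(1) that] .
  have pos: "?f (\<phi> t) > 0" if "t \<in> interior I" for t
    using val p\<phi> p\<psi> t0 that by simp
  have pos\<phi>: "\<phi> t > 0" if "t \<in> interior I" for t
    using index_function_on_pos[OF \<phi>(1) index_domain_basics(1)[OF I]] t0 that by blast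
  have mono: "?f (\<phi> s) < ?f (\<phi> t)"
    if st: "s \<in> interior I" "t \<in> interior I" "\<phi> s < \<phi> t" for s t
  proof -
    have "mono_on I \<phi>"
      using \<phi>(1) by (auto simp: index_function_on_def intro: strict_mono_on_imp_mono_on)
    then have "s < t"
      using st t0(2) by (meson leD mono_onD not_le_imp_less)
    have "deriv \<psi> s < deriv \<psi> t"
      using strictly_convex_on_deriv_strict_mono[OF \<psi>(2)] \<open>s < t\<close> st t0(1) d\<psi>(1) by simp
    moreover have "deriv \<phi> t \<le> deriv \<phi> s"
      using concave_on_deriv_antimono[OF \<phi>(2)] \<open>s < t\<close> st d\<phi>(1) by simp
    ultimately have "deriv \<psi> s / deriv \<phi> s < deriv \<psi> t / deriv \<phi> t"
      using p\<phi> p\<psi> t0(1) st by (intro frac_less) (auto intro: less_imp_le)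
    then show ?thesis using val st by simp
  qed
  have cont: "isCont ?f (\<phi> t)" if t: "t \<in> interior I" for t
  proof -
    have inv: "inv_into I \<phi> (\<phi> t) = t"
      using t0(2)[OF t] \<phi>(1)
      by (auto simp: index_function_on_def intro!: inv_into_f_f strict_mono_on_imp_inj_on)
    have ic: "isCont (inv_into I \<phi>) (\<phi> t)"
      using isCont_inv_into_index_function[OF I \<phi>(1) t] .
    have "isCont (deriv \<psi>) (inv_into I \<phi> (\<phi> t))" "isCont (deriv \<phi>) (inv_into I \<phi> (\<phi> t))"
      unfolding inv using d\<psi>(2)[OF t0(1)[OF t]] d\<phi>(2)[OF t]
      by (auto intro: differentiable_imp_continuous_within)
    then have "isCont (\<lambda>s. deriv \<psi> (inv_into I \<phi> s) / deriv \<phi> (inv_into I \<phi> s)) (\<phi> t)"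
      using p\<phi>[OF t] by (intro continuous_divide isCont_o2[OF ic]) (auto simp: inv)
    moreover have "eventually (\<lambda>s. s \<noteq> 0) (nhds (\<phi> t))"
      using pos\<phi>[OF t] by (intro t1_space_nhds) auto
    then have "eventually (\<lambda>s. deriv \<psi> (inv_into I \<phi> s) / deriv \<phi> (inv_into I \<phi> s) = ?f s) (nhds (\<phi> t))"
      by eventually_elim (simp add: quotient_index_def)
    ultimately show ?thesis by (simp add: isCont_cong)
  qed
  have cont0: "(?f \<longlongrightarrow> ?f 0) (at 0 within insert 0 ?J)"
  proof -
    have "at 0 within insert 0 ?J = at 0 within ?J"
      by (simp add: at_within_def)
    also have "\<dots> \<le> at_right 0" using pos\<phi> by (intro at_le) auto
    finally show ?thesis unfolding f0 using lim by (rule tendsto_mono)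
  qed
  show ?thesis
    unfolding index_function_on_def
  proof (intro conjI)
    show "?f ` insert 0 ?J \<subseteq> {0..}" using f0 pos by (auto intro: less_imp_le)
    show "continuous_on (insert 0 ?J) ?f"
      unfolding continuous_on_def
    proof
      fix s assume "s \<in> insert 0 ?J"
      then show "(?f \<longlongrightarrow> ?f s) (at s within insert 0 ?J)"
        using cont0 cont by (auto simp: isCont_def intro: tendsto_within_subset)
    qed
    show "strict_mono_on (insert 0 ?J) ?f"
    proof (rule strict_mono_onI)
      fix s t assume st: "s \<in> insert 0 ?J" "t \<in> insert 0 ?J" "s < t"
      have "0 \<le> s" using st(1) pos\<phi> by (auto intro: less_imp_le)
      then obtain v where v: "v \<in> interior I" "t = \<phi> v" using st by auto
      show "?f s < ?f t"
      proof (cases "s = 0")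
        case True
        then show ?thesis using pos[OF v(1)] v(2) f0 by simp
      next
        case False
        then obtain u where "u \<in> interior I" "s = \<phi> u" using st(1) by auto
        then show ?thesis using mono v st(3) by simp
      qed
    qed
  qed (fact f0)
qed

section \<open>Rate of convergence\<close>

text \<open>The weight \<open>\<phi>'(t)/\<psi>'(t)\<close> makes the tangents of \<open>\<phi>\<close> and of the weighted \<open>\<psi>\<close> parallel, so
  their slopes cancel. The second bound then does not depend on \<open>s\<close> and plays the part of a Young
  inequality. The first compares the two parallel tangents at \<open>0\<close>, where that of \<open>\<phi>\<close> is
  nonnegative and that of the weighted \<open>\<psi>\<close> is nonpositive.\<close>

lemma weighted_tangent_bounds:
  assumes I: "index_domain I"
    and \<phi>: "index_function_on I \<phi>" "concave_on I \<phi>" "\<phi> differentiable (at t)"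
    and \<psi>: "index_function_on {0..} \<psi>" "strictly_convex_on {0..} \<psi>" "\<psi> differentiable (at t)"
    and t: "t \<in> interior I"
  shows "deriv \<phi> t / deriv \<psi> t * \<psi> t \<le> \<phi> t"
    and "s \<in> I \<Longrightarrow> \<phi> s - deriv \<phi> t / deriv \<psi> t * \<psi> s \<le> \<phi> t"
proof -
  let ?q = "deriv \<phi> t / deriv \<psi> t"
  have t0: "t > 0" using t index_domain_basics[OF I] by auto
  have ti: "t \<in> interior {0..}" using t0 by simp
  have p: "deriv \<psi> t > 0" "deriv \<phi> t > 0"
    using strictly_convex_index_deriv_pos[OF \<psi>(1,2) t0 \<psi>(3)]
      concave_index_deriv_pos[OF I \<phi>(1,2) t \<phi>(3)] by auto
  have nn: "\<psi> t \<ge> 0" using index_function_on_nonneg[OF \<psi>(1)] t0 by simp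
  have lower: "?q * \<psi> t + deriv \<phi> t * (s - t) \<le> ?q * \<psi> s" if "s \<ge> 0" for s
  proof -
    have "\<psi> t + deriv \<psi> t * (s - t) \<le> \<psi> s"
      using convex_on_above_deriv_tangent[OF strictly_convex_on_imp_convex_on[OF \<psi>(2)] ti _ \<psi>(3)] that
      by simp
    then have "?q * (\<psi> t + deriv \<psi> t * (s - t)) \<le> ?q * \<psi> s"
      using p by (intro mult_left_mono) auto
    then show ?thesis using p(1) by (simp add: distrib_left)
  qed
  have upper: "\<phi> s \<le> \<phi> t + deriv \<phi> t * (s - t)" if "s \<in> I" for s
    using concave_on_below_deriv_tangent[OF \<phi>(2) t that \<phi>(3)] .
  have "0 \<le> \<phi> t - deriv \<phi> t * t"
    using upper[OF index_domain_basics(1)[OF I]] \<phi>(1) by (simp add: index_function_on_def)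
  moreover have "?q * \<psi> t - deriv \<phi> t * t \<le> 0"
    using lower[of 0] \<psi>(1) by (simp add: index_function_on_def)
  ultimately show "?q * \<psi> t \<le> \<phi> t" by linarith
  have "0 \<le> ?q * \<psi> t" using p nn by simp
  moreover assume "s \<in> I"
  moreover from this have "s \<ge> 0" using index_domain_basics(3)[OF I] by auto
  ultimately show "\<phi> s - ?q * \<psi> s \<le> \<phi> t" using upper[of s] lower[of s] by linarith
qed

text \<open>The first bound drops the residual of the minimizer. The second keeps it, converting it from
  the noisy to the exact data at the cost of the constants \<open>a\<close> and \<open>b\<close>.\<close>

lemma penalty_gap_le:
  fixes F :: "'a \<Rightarrow> 'b::real_normed_vector"
  assumes \<psi>: "index_function_on {0..} \<psi>"
    and quasi: "\<And>u v. u \<ge> 0 \<Longrightarrow> v \<ge> 0 \<Longrightarrow> \<psi> (u + v) \<le> a * \<psi> u + b * \<psi> v"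
    and ab: "a > 0" "b > 0"
    and sol: "x0 \<in> D" "F x0 = y" and noise: "norm (z - y) \<le> \<delta>"
    and min: "is_arg_min (tikhonov \<psi> F W z \<alpha>) (\<lambda>x. x \<in> D) x"
  shows "\<alpha> * (W x - W x0) \<le> \<psi> \<delta>"
    and "a * (\<alpha> * (W x - W x0)) + \<psi> (norm (F x - y)) \<le> (a + b) * \<psi> \<delta>"
proof -
  have mono: "\<psi> u \<le> \<psi> v" if "0 \<le> u" "u \<le> v" for u v
    using \<psi> that unfolding index_function_on_def by (intro strict_mono_on_leD[of "{0..}" \<psi>]) auto
  have "tikhonov \<psi> F W z \<alpha> x \<le> tikhonov \<psi> F W z \<alpha> x0"
    using min sol(1) by (auto simp: is_arg_min_linorder)
  moreover have "\<psi> (norm (F x0 - z)) \<le> \<psi> \<delta>"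
    using mono noise sol(2) by (simp add: norm_minus_commute)
  ultimately have gap: "\<psi> (norm (F x - z)) + \<alpha> * (W x - W x0) \<le> \<psi> \<delta>"
    by (simp add: tikhonov_def algebra_simps)
  moreover have "0 \<le> \<psi> (norm (F x - z))" using index_function_on_nonneg[OF \<psi>] by simp
  ultimately show "\<alpha> * (W x - W x0) \<le> \<psi> \<delta>" by linarith
  have "norm (F x - y) \<le> norm (F x - z) + norm (z - y)"
    using norm_triangle_ineq[of "F x - z" "z - y"] by simp
  then have "\<psi> (norm (F x - y)) \<le> \<psi> (norm (F x - z) + norm (z - y))" by (simp add: mono)
  also have "\<dots> \<le> a * \<psi> (norm (F x - z)) + b * \<psi> (norm (z - y))" by (simp add: quasi)
  also have "\<dots> \<le> a * \<psi> (norm (F x - z)) + b * \<psi> \<delta>" using mono noise ab by simp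
  finally have "\<psi> (norm (F x - y)) \<le> a * \<psi> (norm (F x - z)) + b * \<psi> \<delta>" .
  moreover have "a * (\<psi> (norm (F x - z)) + \<alpha> * (W x - W x0)) \<le> a * \<psi> \<delta>"
    using gap ab by (intro mult_left_mono) auto
  ultimately show "a * (\<alpha> * (W x - W x0)) + \<psi> (norm (F x - y)) \<le> (a + b) * \<psi> \<delta>"
    by (simp add: algebra_simps)
qed

theorem theorem3:
  fixes F :: "'x::banach \<Rightarrow> 'y::banach" and DF :: "'x set"
    and \<Omega> :: "'x \<Rightarrow> real" and DW D :: "'x set"
    and \<psi> \<phi> f :: "real \<Rightarrow> real" and I :: "real set"
    and y :: 'y and xd :: 'x
    and F' :: "'x \<Rightarrow>\<^sub>L 'y" and \<xi> :: "'x \<Rightarrow>\<^sub>L real"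
    and a b \<alpha>max \<rho> \<beta>1 \<beta>2 :: real and \<alpha> :: "real \<Rightarrow> real"
  assumes \<Omega>_nonneg: "\<And>x. x \<in> DW \<Longrightarrow> \<Omega> x \<ge> 0"
    and D_def: "D = DF \<inter> DW"
    and y_attained: "y \<in> F ` DF"
    \<comment> \<open>operator and penalty\<close>
    and F_weak: "weakly_seq_continuous_closed_on DF F"
    and \<Omega>_convex: "convex_on DW \<Omega>"
    and \<Omega>_lsc: "weakly_seq_lsc_on DW \<Omega>"
    and D_nonempty: "D \<noteq> {}"
    and sublevel_compact:
      "\<And>\<alpha> c. \<alpha> > 0 \<Longrightarrow> c \<ge> 0 \<Longrightarrow> weakly_seq_precompact (tikhonov_sublevel \<psi> F \<Omega> D y \<alpha> c)"
    \<comment> \<open>fitting function \<open>\<psi>\<close>\<close>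
    and \<psi>_index: "index_function_on {0..} \<psi>"
    and ab_pos: "a > 0" "b > 0"
    and \<psi>_quasi: "\<And>u v. u \<ge> 0 \<Longrightarrow> v \<ge> 0 \<Longrightarrow> \<psi> (u + v) \<le> a * \<psi> u + b * \<psi> v"
    \<comment> \<open>the solution \<open>xd\<close>, derivatives of \<open>F\<close> and \<open>\<Omega>\<close> there\<close>
    and xd_minimizing: "minimizing_solution F \<Omega> D y xd"
    and F_gateaux: "has_gateaux_derivative_on DF F F' xd"
    and \<Omega>_gateaux: "has_gateaux_derivative_on DW \<Omega> \<xi> xd"
    and \<Omega>_subdiff: "subdifferential DW \<Omega> xd = {\<xi>}"
    \<comment> \<open>the index functions \<open>\<psi>\<close>, \<open>\<phi>\<close> and \<open>f\<close>\<close>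
    and I_domain: "index_domain I"
    and \<phi>_index: "index_function_on I \<phi>"
    and \<psi>_diff: "twice_differentiable_on {0<..} \<psi>"
    and \<phi>_diff: "twice_differentiable_on (interior I) \<phi>"
    and \<psi>_convex: "strictly_convex_on {0..} \<psi>"
    and \<phi>_concave: "concave_on I \<phi>"
    and f_def: "f = quotient_index I \<psi> \<phi>"
    and f_cont_0: "(f \<longlongrightarrow> 0) (at_right 0)"
    \<comment> \<open>the variational inequality\<close>
    and \<alpha>max_pos: "\<alpha>max > 0"
    and \<rho>_def: "\<rho> = \<alpha>max * (1 + \<Omega> xd)"
    and \<beta>1: "0 \<le> \<beta>1" "\<beta>1 < 1"
    and \<beta>2: "\<beta>2 > 0"
    and residual_dom: "\<And>x. x \<in> tikhonov_sublevel \<psi> F \<Omega> D y \<alpha>max \<rho> \<Longrightarrow> norm (F x - F xd) \<in> I"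
    and variational_inequality:
      "\<And>x. x \<in> tikhonov_sublevel \<psi> F \<Omega> D y \<alpha>max \<rho> \<Longrightarrow>
        blinfun_apply \<xi> (xd - x) \<le> \<beta>1 * bregman \<Omega> \<xi> x xd + \<beta>2 * \<phi> (norm (F x - F xd))"
    \<comment> \<open>the a priori parameter choice\<close>
    and \<alpha>_def: "\<alpha> = (\<lambda>\<delta>. 1 / (a * \<beta>2) * f (\<phi> \<delta>))"
  shows "index_function_on (insert 0 (\<phi> ` interior I)) f \<and>
    (\<exists>c0>0. \<exists>\<delta>0>0. \<forall>\<delta>. 0 < \<delta> \<and> \<delta> \<le> \<delta>0 \<longrightarrow>
      (\<forall>y\<delta> x\<delta>. norm (y\<delta> - y) \<le> \<delta> \<and>
          is_arg_min (tikhonov \<psi> F \<Omega> y\<delta> (\<alpha> \<delta>)) (\<lambda>x. x \<in> D) x\<delta> \<longrightarrow>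
        bregman \<Omega> \<xi> x\<delta> xd \<le> c0 * \<phi> \<delta>))"
proof -
  have basics: "0 \<in> I" "interior I \<subseteq> I" "I \<subseteq> {0..}" "interior I \<subseteq> {0<..}"
    using index_domain_basics[OF I_domain] by auto
  have index: "index_function_on (insert 0 (\<phi> ` interior I)) f"
    unfolding f_def
    using index_function_on_quotient_index[OF I_domain \<phi>_index \<phi>_concave \<phi>_diff \<psi>_index \<psi>_convex
        \<psi>_diff] f_cont_0 f_def by blast
  have xd: "xd \<in> D" "F xd = y"
    using xd_minimizing by (auto simp: minimizing_solution_def is_arg_min_def)
  have \<Omega>xd: "0 \<le> \<Omega> xd" using \<Omega>_nonneg xd(1) D_def by blast

  have d\<phi>: "\<phi> differentiable (at t)" if "t \<in> interior I" for t
    using \<phi>_diff that by (auto simp: twice_differentiable_on_def)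
  have d\<psi>: "\<psi> differentiable (at t)" if "t \<in> interior I" for t
    using \<psi>_diff that basics(4) by (auto simp: twice_differentiable_on_def)
  define q where "q = (\<lambda>t. deriv \<phi> t / deriv \<psi> t)"
  have q_bounds: "q t > 0" "q t * \<psi> t \<le> \<phi> t" "\<And>s. s \<in> I \<Longrightarrow> \<phi> s - q t * \<psi> s \<le> \<phi> t"
    and \<phi>_pos: "0 < \<phi> t" and \<alpha>_pos: "\<alpha> t > 0" and \<alpha>_q: "1 / \<alpha> t = a * (\<beta>2 * q t)"
    if t: "t \<in> interior I" for t
  proof -
    have "t > 0" "t \<in> I" using t basics by auto
    have p: "deriv \<psi> t > 0" "deriv \<phi> t > 0"
      using strictly_convex_index_deriv_pos[OF \<psi>_index \<psi>_convex \<open>t > 0\<close> d\<psi>[OF t]]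
        concave_index_deriv_pos[OF I_domain \<phi>_index \<phi>_concave t d\<phi>[OF t]] by auto
    then show "q t > 0" by (simp add: q_def)
    note tb = weighted_tangent_bounds[OF I_domain \<phi>_index \<phi>_concave d\<phi>[OF t] \<psi>_index \<psi>_convex
        d\<psi>[OF t] t]
    show "q t * \<psi> t \<le> \<phi> t" "\<And>s. s \<in> I \<Longrightarrow> \<phi> s - q t * \<psi> s \<le> \<phi> t"
      unfolding q_def using tb by auto
    show "0 < \<phi> t" using index_function_on_pos[OF \<phi>_index basics(1) \<open>t \<in> I\<close> \<open>t > 0\<close>] .
    have "f (\<phi> t) = deriv \<psi> t / deriv \<phi> t"
      unfolding f_def using quotient_index_image[OF I_domain \<phi>_index t] .
    then show "\<alpha> t > 0" "1 / \<alpha> t = a * (\<beta>2 * q t)"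
      using p ab_pos \<beta>2 by (auto simp: \<alpha>_def q_def)
  qed
  have gap: "a * (\<Omega> x - \<Omega> xd) + a * (\<beta>2 * q t) * \<psi> (norm (F x - y)) \<le> (a + b) * (a * \<beta>2 * \<phi> t)"
    "\<Omega> x - \<Omega> xd \<le> a * \<beta>2 * \<phi> t"
    "\<psi> (norm (F x - y)) \<le> (a + b) * \<psi> t + a * \<alpha> t * \<Omega> xd"
    if t: "t \<in> interior I" and noise: "norm (z - y) \<le> t"
      and min: "is_arg_min (tikhonov \<psi> F \<Omega> z (\<alpha> t)) (\<lambda>x. x \<in> D) x" for t z x
  proof -
    note pg = penalty_gap_le[OF \<psi>_index \<psi>_quasi ab_pos xd noise min]
    have q\<psi>: "a * (\<beta>2 * q t) * \<psi> t \<le> a * \<beta>2 * \<phi> t"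
      using q_bounds(2)[OF t] ab_pos \<beta>2 by simp
    have \<alpha>q: "a * (\<beta>2 * q t) * \<alpha> t = 1" using \<alpha>_q[OF t] \<alpha>_pos[OF t] by (simp add: field_simps)
    have k: "0 \<le> a * (\<beta>2 * q t)" using ab_pos \<beta>2 q_bounds(1)[OF t] by simp
    \<comment> \<open>dividing by \<open>\<alpha> t\<close> is multiplying by \<open>a * (\<beta>2 * q t)\<close>\<close>
    have "a * (\<beta>2 * q t) * (\<alpha> t * (\<Omega> x - \<Omega> xd)) \<le> a * (\<beta>2 * q t) * \<psi> t"
      using pg(1) k by (rule mult_left_mono)
    also have "a * (\<beta>2 * q t) * (\<alpha> t * (\<Omega> x - \<Omega> xd)) = (a * (\<beta>2 * q t) * \<alpha> t) * (\<Omega> x - \<Omega> xd)"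
      by (simp only: mult.assoc)
    finally show "\<Omega> x - \<Omega> xd \<le> a * \<beta>2 * \<phi> t" using q\<psi> unfolding \<alpha>q by simp
    have "a * (\<beta>2 * q t) * (a * (\<alpha> t * (\<Omega> x - \<Omega> xd)) + \<psi> (norm (F x - y)))
        \<le> a * (\<beta>2 * q t) * ((a + b) * \<psi> t)"
      using pg(2) k by (rule mult_left_mono)
    also have "\<dots> = (a + b) * (a * (\<beta>2 * q t) * \<psi> t)" by (simp only: ac_simps)
    also have "\<dots> \<le> (a + b) * (a * \<beta>2 * \<phi> t)" using q\<psi> ab_pos by (intro mult_left_mono) auto
    also have "a * (\<beta>2 * q t) * (a * (\<alpha> t * (\<Omega> x - \<Omega> xd)) + \<psi> (norm (F x - y)))
        = (a * (\<beta>2 * q t) * \<alpha> t) * (a * (\<Omega> x - \<Omega> xd)) + a * (\<beta>2 * q t) * \<psi> (norm (F x - y))"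
      by (simp add: algebra_simps)
    finally show "a * (\<Omega> x - \<Omega> xd) + a * (\<beta>2 * q t) * \<psi> (norm (F x - y)) \<le> (a + b) * (a * \<beta>2 * \<phi> t)"
      unfolding \<alpha>q by simp
    have "x \<in> DW" using min D_def by (auto simp: is_arg_min_def)
    then have "0 \<le> a * \<alpha> t * \<Omega> x" using \<Omega>_nonneg ab_pos \<alpha>_pos[OF t] by simp
    then show "\<psi> (norm (F x - y)) \<le> (a + b) * \<psi> t + a * \<alpha> t * \<Omega> xd"
      using pg(2) by (simp add: algebra_simps)
  qed

  \<comment> \<open>For small \<open>t\<close> the excess of a minimizer over \<open>\<alpha>max * \<Omega> xd\<close> in the noise-free functional
    with parameter \<open>\<alpha>max\<close> is less than \<open>\<alpha>max\<close>, which is the slack in \<open>\<rho>\<close>.\<close>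
  have \<phi>0: "(\<phi> \<longlongrightarrow> 0) (at_right 0)"
    using index_function_on_tendsto_0[OF I_domain \<phi>_index] .
  have \<psi>0: "(\<psi> \<longlongrightarrow> 0) (at_right 0)"
    by (rule index_function_on_tendsto_0[OF _ \<psi>_index]) (simp add: index_domain_def)
  have in_int: "eventually (\<lambda>t. t \<in> interior I) (at_right 0)"
    using eventually_interior_index_domain[OF I_domain] .
  have "filterlim \<phi> (at_right 0) (at_right 0)"
    unfolding filterlim_at
  proof
    show "eventually (\<lambda>t. \<phi> t \<in> {0<..} \<and> \<phi> t \<noteq> 0) (at_right 0)"
      using in_int by eventually_elim (use \<phi>_pos in force)
  qed (fact \<phi>0)
  then have "((\<lambda>t. f (\<phi> t)) \<longlongrightarrow> 0) (at_right 0)" by (rule filterlim_compose[OF f_cont_0])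
  then have \<alpha>0: "(\<alpha> \<longlongrightarrow> 0) (at_right 0)"
    unfolding \<alpha>_def by (rule tendsto_mult_right_zero)
  define r where "r = (\<lambda>t. (a + b) * \<psi> t + a * \<alpha> t * \<Omega> xd + \<alpha>max * (a * \<beta>2 * \<phi> t))"
  have "(r \<longlongrightarrow> (a + b) * 0 + a * 0 * \<Omega> xd + \<alpha>max * (a * \<beta>2 * 0)) (at_right 0)"
    unfolding r_def by (intro tendsto_intros \<phi>0 \<psi>0 \<alpha>0)
  then have "(r \<longlongrightarrow> 0) (at_right 0)" by simp
  then have "eventually (\<lambda>t. r t < \<alpha>max) (at_right 0)"
    using \<alpha>max_pos by (rule order_tendstoD)
  with in_int have "eventually (\<lambda>t. t \<in> interior I \<and> r t < \<alpha>max) (at_right 0)"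
    by (rule eventually_conj)
  then obtain e where e: "e > 0" "\<And>t. 0 < t \<Longrightarrow> t < e \<Longrightarrow> t \<in> interior I \<and> r t < \<alpha>max"
    unfolding eventually_at_right_field by blast

  have rate: "bregman \<Omega> \<xi> x xd \<le> \<beta>2 * (a + b + 1) / (1 - \<beta>1) * \<phi> t"
    if t: "0 < t" "t < e" and noise: "norm (z - y) \<le> t"
      and min: "is_arg_min (tikhonov \<psi> F \<Omega> z (\<alpha> t)) (\<lambda>x. x \<in> D) x" for t z x
  proof -
    have int: "t \<in> interior I" and rt: "r t < \<alpha>max" using e(2)[OF t] by auto
    note g = gap[OF int noise min]
    let ?s = "norm (F x - y)"
    have "\<alpha>max * (\<Omega> x - \<Omega> xd) \<le> \<alpha>max * (a * \<beta>2 * \<phi> t)"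
      using g(2) \<alpha>max_pos by (intro mult_left_mono) auto
    then have "tikhonov \<psi> F \<Omega> y \<alpha>max x \<le> \<rho>"
      using g(3) rt unfolding tikhonov_def \<rho>_def r_def by (simp add: right_diff_distrib distrib_left)
    moreover have "x \<in> D" using min by (simp add: is_arg_min_def)
    ultimately have mem: "x \<in> tikhonov_sublevel \<psi> F \<Omega> D y \<alpha>max \<rho>"
      by (simp add: tikhonov_sublevel_def)
    have s: "?s \<in> I" using residual_dom[OF mem] xd(2) by simp
    have "a * ((\<Omega> x - \<Omega> xd) + \<beta>2 * q t * \<psi> ?s) \<le> a * ((a + b) * (\<beta>2 * \<phi> t))"
      using g(1) by (simp add: algebra_simps)
    then have gap': "(\<Omega> x - \<Omega> xd) + \<beta>2 * q t * \<psi> ?s \<le> (a + b) * (\<beta>2 * \<phi> t)"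
      using ab_pos by simp
    have "bregman \<Omega> \<xi> x xd = (\<Omega> x - \<Omega> xd) + blinfun_apply \<xi> (xd - x)"
      by (simp add: bregman_def blinfun.diff_right)
    also have "\<dots> \<le> (a + b) * (\<beta>2 * \<phi> t) + \<beta>1 * bregman \<Omega> \<xi> x xd + \<beta>2 * (\<phi> ?s - q t * \<psi> ?s)"
      using gap' variational_inequality[OF mem] xd(2) by (simp add: algebra_simps)
    also have "\<dots> \<le> (a + b) * (\<beta>2 * \<phi> t) + \<beta>1 * bregman \<Omega> \<xi> x xd + \<beta>2 * \<phi> t"
      using q_bounds(3)[OF int s] \<beta>2 by simp
    finally have "(1 - \<beta>1) * bregman \<Omega> \<xi> x xd \<le> \<beta>2 * (a + b + 1) * \<phi> t"
      by (simp add: algebra_simps)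
    then show ?thesis using \<beta>1(2) by (simp add: pos_le_divide_eq mult.commute)
  qed
  have "\<beta>2 * (a + b + 1) / (1 - \<beta>1) > 0" using \<beta>1 \<beta>2 ab_pos by simp
  moreover have "e / 2 > 0" using e(1) by simp
  moreover have "t < e" if "t \<le> e / 2" for t using that e(1) by simp
  ultimately show ?thesis using index rate by blast
qed

end
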